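(* Let $\Gamma$ be an abelian group and $f:\Gamma\to\mathbb{C}$ a function with $f(0)=0$ and $\big(f(\alpha+\beta)-f(\alpha)-f(\beta)\big)\big(f(\alpha)-f(\beta)\big)=0$ for all $\alpha,\beta\in\Gamma$. Let $\Gamma_0=f^{-1}(0)$ and suppose $|f(\Gamma)|=3$. Then the $\frac12$-derivations of $V(f)$ are exactly the linear maps $\varphi:V(f)\to V(f)$ of the form $$\varphi(e_\alpha)=\sum_{\gamma\in\Gamma_0} a_\gamma e_{\alpha+\gamma}\qquad(\alpha\in\Gamma),$$ where $\{a_\gamma\}_{\gamma\in\Gamma_0}\subseteq\mathbb{C}$ is a family having only a finite number of non-zero elements.
   Context: The Witt type Lie algebra $V(f)$ is the complex vector space with basis $\{e_\alpha\}_{\alpha\in\Gamma}$ and bracket $[e_\alpha,e_\beta]=(f(\beta)-f(\alpha))e_{\alpha+\beta}$. A $\frac12$-derivation of a Lie algebra $(L,[\cdot,\cdot])$ is a linear map $\varphi:L\to L$ with $\varphi([x,y])=\frac12\big([\varphi(x),y]+[x,\varphi(y)]\big)$ for all $x,y\in L$. *)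

theory Defs
  imports Complex_Main "HOL-Library.Poly_Mapping"
begin

text \<open>
  The underlying space of \<open>V(f)\<close> is the space \<open>'g \<Rightarrow>\<^sub>0 complex\<close> of finitely supported functions
  on \<open>\<Gamma> = UNIV :: 'g set\<close>; it does not depend on \<open>f\<close>, which enters only through the bracket.
\<close>

definition witt_scale :: "complex \<Rightarrow> ('g \<Rightarrow>\<^sub>0 complex) \<Rightarrow> ('g \<Rightarrow>\<^sub>0 complex)" where
  "witt_scale c x = Poly_Mapping.map ((*) c) x"

definition witt_basis :: "'g \<Rightarrow> ('g \<Rightarrow>\<^sub>0 complex)" where
  "witt_basis \<alpha> = Poly_Mapping.single \<alpha> 1"

text \<open>The bilinear extension of \<open>[e\<^sub>\<alpha>, e\<^sub>\<beta>] = (f \<beta> - f \<alpha>) e\<^sub>\<alpha>\<^sub>+\<^sub>\<beta>\<close>; see \<open>witt_bracket_basis\<close> and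
  \<open>bilinear_witt_bracket\<close> below.\<close>

definition witt_bracket ::
  "('g::ab_group_add \<Rightarrow> complex) \<Rightarrow> ('g \<Rightarrow>\<^sub>0 complex) \<Rightarrow> ('g \<Rightarrow>\<^sub>0 complex) \<Rightarrow> ('g \<Rightarrow>\<^sub>0 complex)" where
  "witt_bracket f x y =
     (\<Sum>\<alpha>\<in>Poly_Mapping.keys x. \<Sum>\<beta>\<in>Poly_Mapping.keys y.
        witt_scale (Poly_Mapping.lookup x \<alpha> * Poly_Mapping.lookup y \<beta> * (f \<beta> - f \<alpha>)) (witt_basis (\<alpha> + \<beta>)))"

definition half_derivation ::
  "(complex \<Rightarrow> 'v \<Rightarrow> 'v) \<Rightarrow> ('v \<Rightarrow> 'v \<Rightarrow> 'v) \<Rightarrow> ('v::ab_group_add \<Rightarrow> 'v) \<Rightarrow> bool" where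
  "half_derivation scale br \<phi> \<longleftrightarrow>
     Vector_Spaces.linear scale scale \<phi> \<and>
     (\<forall>x y. \<phi> (br x y) = scale (1 / 2) (br (\<phi> x) y + br x (\<phi> y)))"

lemma lookup_witt_scale [simp]: "Poly_Mapping.lookup (witt_scale c x) \<alpha> = c * Poly_Mapping.lookup x \<alpha>"
  by (simp add: witt_scale_def Poly_Mapping.map.rep_eq when_def)

lemma vector_space_witt_scale: "vector_space witt_scale"
  by unfold_locales (auto intro!: poly_mapping_eqI simp: lookup_add algebra_simps)

lemma witt_basis_expansion: "x = (\<Sum>\<alpha>\<in>Poly_Mapping.keys x. witt_scale (Poly_Mapping.lookup x \<alpha>) (witt_basis \<alpha>))"
  by (rule poly_mapping_eqI)
     (auto simp: lookup_sum witt_basis_def lookup_single when_def in_keys_iff sum.delta'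
           if_distrib cong: if_cong)

lemma witt_bracket_basis:
  "witt_bracket f (witt_basis \<alpha>) (witt_basis \<beta>) = witt_scale (f \<beta> - f \<alpha>) (witt_basis (\<alpha> + \<beta>))"
  by (simp add: witt_bracket_def) (simp add: witt_basis_def)

lemma witt_bracket_superset:
  assumes "finite A" "finite B" "Poly_Mapping.keys x \<subseteq> A" "Poly_Mapping.keys y \<subseteq> B"
  shows "witt_bracket f x y =
    (\<Sum>\<alpha>\<in>A. \<Sum>\<beta>\<in>B. witt_scale (Poly_Mapping.lookup x \<alpha> * Poly_Mapping.lookup y \<beta> * (f \<beta> - f \<alpha>)) (witt_basis (\<alpha> + \<beta>)))"
proof -
  have z: "witt_scale 0 v = 0" for v :: "'a \<Rightarrow>\<^sub>0 complex"
    by (rule poly_mapping_eqI) simp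
  have "witt_bracket f x y =
    (\<Sum>\<alpha>\<in>Poly_Mapping.keys x. \<Sum>\<beta>\<in>B. witt_scale (Poly_Mapping.lookup x \<alpha> * Poly_Mapping.lookup y \<beta> * (f \<beta> - f \<alpha>)) (witt_basis (\<alpha> + \<beta>)))"
    unfolding witt_bracket_def
    by (intro sum.cong refl sum.mono_neutral_left) (use assms in \<open>auto simp: in_keys_iff z\<close>)
  also have "\<dots> =
    (\<Sum>\<alpha>\<in>A. \<Sum>\<beta>\<in>B. witt_scale (Poly_Mapping.lookup x \<alpha> * Poly_Mapping.lookup y \<beta> * (f \<beta> - f \<alpha>)) (witt_basis (\<alpha> + \<beta>)))"
    by (intro sum.mono_neutral_left) (use assms in \<open>auto simp: in_keys_iff z\<close>)
  finally show ?thesis .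
qed

lemma bilinear_witt_bracket:
  "Vector_Spaces.linear witt_scale witt_scale (\<lambda>x. witt_bracket f x y)"
  "Vector_Spaces.linear witt_scale witt_scale (\<lambda>y. witt_bracket f x y)"
proof -
  interpret vector_space "witt_scale :: complex \<Rightarrow> ('a \<Rightarrow>\<^sub>0 complex) \<Rightarrow> _"
    by (rule vector_space_witt_scale)
  have keys_scale: "Poly_Mapping.keys (witt_scale c v) \<subseteq> Poly_Mapping.keys v" for c and v :: "'a \<Rightarrow>\<^sub>0 complex"
    by (auto simp: in_keys_iff)
  have add1: "witt_bracket f (u + v) y = witt_bracket f u y + witt_bracket f v y" for u v y
  proof -
    let ?A = "Poly_Mapping.keys u \<union> Poly_Mapping.keys v"
    have "witt_bracket f w y = (\<Sum>\<alpha>\<in>?A. \<Sum>\<beta>\<in>Poly_Mapping.keys y.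
        witt_scale (Poly_Mapping.lookup w \<alpha> * Poly_Mapping.lookup y \<beta> * (f \<beta> - f \<alpha>)) (witt_basis (\<alpha> + \<beta>)))"
      if "Poly_Mapping.keys w \<subseteq> ?A" for w
      using that by (intro witt_bracket_superset) auto
    then show ?thesis
      using Poly_Mapping.keys_add[of u v]
      by (simp add: lookup_add distrib_right scale_left_distrib sum.distrib)
  qed
  have add2: "witt_bracket f x (u + v) = witt_bracket f x u + witt_bracket f x v" for u v x
  proof -
    let ?B = "Poly_Mapping.keys u \<union> Poly_Mapping.keys v"
    have "witt_bracket f x w = (\<Sum>\<alpha>\<in>Poly_Mapping.keys x. \<Sum>\<beta>\<in>?B.
        witt_scale (Poly_Mapping.lookup x \<alpha> * Poly_Mapping.lookup w \<beta> * (f \<beta> - f \<alpha>)) (witt_basis (\<alpha> + \<beta>)))"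
      if "Poly_Mapping.keys w \<subseteq> ?B" for w
      using that by (intro witt_bracket_superset) auto
    then show ?thesis
      using Poly_Mapping.keys_add[of u v]
      by (simp add: lookup_add distrib_right distrib_left scale_left_distrib sum.distrib)
  qed
  have scale1: "witt_bracket f (witt_scale c u) y = witt_scale c (witt_bracket f u y)" for c u y
    by (subst witt_bracket_superset[OF _ _ keys_scale subset_refl])
       (simp_all add: witt_bracket_def scale_sum_right mult.assoc)
  have scale2: "witt_bracket f x (witt_scale c u) = witt_scale c (witt_bracket f x u)" for c u x
    by (subst witt_bracket_superset[OF _ _ subset_refl keys_scale])
       (simp_all add: witt_bracket_def scale_sum_right mult.assoc mult.left_commute)
  show "Vector_Spaces.linear witt_scale witt_scale (\<lambda>x. witt_bracket f x y)"
    by (simp add: Vector_Spaces.linear_iff vector_space_witt_scale add1 scale1)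
  show "Vector_Spaces.linear witt_scale witt_scale (\<lambda>y. witt_bracket f x y)"
    by (simp add: Vector_Spaces.linear_iff vector_space_witt_scale add2 scale2)
qed

end

theory Submission
  imports Defs
begin

text \<open>
  Expand \<open>\<phi> e\<^sub>\<alpha> = (\<Sum>\<delta>. c \<alpha> \<delta> e\<^sub>\<alpha>\<^sub>+\<^sub>\<delta>)\<close>. Since the bracket is graded by \<open>\<Gamma>\<close>, the identity for a
  \<open>1/2\<close>-derivation splits into one condition for every shift \<open>\<delta>\<close>
  (\<open>half_derivation_iff_coefficients\<close>):
  \<open>2 (f \<beta> - f \<alpha>) c (\<alpha> + \<beta>) \<delta> = (f \<beta> - f (\<alpha> + \<delta>)) c \<alpha> \<delta> + (f (\<beta> + \<delta>) - f \<alpha>) c \<beta> \<delta>\<close>.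
  So everything depends on how translation by \<open>\<delta>\<close> acts on the values of \<open>f\<close>. The functional
  equation makes \<open>f\<close> additive on pairs with different values. It follows that \<open>\<Gamma>\<^sub>0\<close> is a group of
  periods of \<open>f\<close>. If \<open>f\<close> has exactly three values, these are \<open>0, d, -d\<close>, and \<open>f\<close> induces a
  bijection of \<open>\<Gamma> / \<Gamma>\<^sub>0\<close>, which is cyclic of order three, with \<open>{0, d, -d}\<close>. Translation by an
  element with value \<open>d\<close> is the cycle \<open>0 \<mapsto> d \<mapsto> -d \<mapsto> 0\<close>.

  For \<open>\<delta> \<in> \<Gamma>\<^sub>0\<close> the condition says that \<open>c (\<alpha> + \<beta>) \<delta>\<close> is the mean of \<open>c \<alpha> \<delta>\<close> and \<open>c \<beta> \<delta>\<close>
  whenever \<open>f \<alpha> \<noteq> f \<beta>\<close>, which forces \<open>c \<alpha> \<delta>\<close> to be independent of \<open>\<alpha>\<close>; conversely constants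
  are solutions. For \<open>\<delta> \<notin> \<Gamma>\<^sub>0\<close> the case \<open>\<beta> = 0\<close> and one pair of opposite values
  leave only the zero solution. Hence \<open>c \<alpha> \<delta> = a \<delta>\<close> for \<open>\<delta> \<in> \<Gamma>\<^sub>0\<close> and \<open>0\<close> otherwise, with finite
  support because \<open>a\<close> can be read off from the single vector \<open>\<phi> e\<^sub>0\<close>.
\<close>

section \<open>Half-derivations in coordinates\<close>

lemma lookup_witt_bracket_basis_right:
  "Poly_Mapping.lookup (witt_bracket f x (witt_basis \<beta>)) \<kappa> =
     (f \<beta> - f (\<kappa> - \<beta>)) * Poly_Mapping.lookup x (\<kappa> - \<beta>)"
proof -
  have "Poly_Mapping.lookup (witt_bracket f x (witt_basis \<beta>)) \<kappa> =
      (\<Sum>\<alpha>\<in>Poly_Mapping.keys x.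
         if \<alpha> = \<kappa> - \<beta> then (f \<beta> - f \<alpha>) * Poly_Mapping.lookup x \<alpha> else 0)"
    by (auto simp: witt_bracket_def witt_basis_def lookup_sum lookup_single when_def algebra_simps
        intro!: sum.cong)
  then show ?thesis
    by (simp add: in_keys_iff)
qed

lemma lookup_witt_bracket_basis_left:
  "Poly_Mapping.lookup (witt_bracket f (witt_basis \<alpha>) y) \<kappa> =
     (f (\<kappa> - \<alpha>) - f \<alpha>) * Poly_Mapping.lookup y (\<kappa> - \<alpha>)"
proof -
  have "Poly_Mapping.lookup (witt_bracket f (witt_basis \<alpha>) y) \<kappa> =
      (\<Sum>\<beta>\<in>Poly_Mapping.keys y.
         if \<beta> = \<kappa> - \<alpha> then (f \<beta> - f \<alpha>) * Poly_Mapping.lookup y \<beta> else 0)"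
    by (auto simp: witt_bracket_def witt_basis_def lookup_sum lookup_single when_def algebra_simps
        intro!: sum.cong)
  then show ?thesis
    by (simp add: in_keys_iff)
qed

lemma poly_mapping_eq_iff_shifted:
  fixes p q :: "'g::ab_group_add \<Rightarrow>\<^sub>0 'b::zero"
  shows "p = q \<longleftrightarrow> (\<forall>\<delta>. Poly_Mapping.lookup p (\<alpha> + \<delta>) = Poly_Mapping.lookup q (\<alpha> + \<delta>))"
proof
  assume eq: "\<forall>\<delta>. Poly_Mapping.lookup p (\<alpha> + \<delta>) = Poly_Mapping.lookup q (\<alpha> + \<delta>)"
  show "p = q"
  proof (rule poly_mapping_eqI)
    fix \<kappa>
    show "Poly_Mapping.lookup p \<kappa> = Poly_Mapping.lookup q \<kappa>"
      using eq[rule_format, of "\<kappa> - \<alpha>"] by simp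
  qed
qed simp

lemma linear_eq_on_witt_basis:
  assumes g: "Vector_Spaces.linear witt_scale s g" and h: "Vector_Spaces.linear witt_scale s h"
    and eq: "\<And>\<alpha>. g (witt_basis \<alpha>) = h (witt_basis \<alpha>)"
  shows "g x = h x"
proof -
  interpret g: Vector_Spaces.linear witt_scale s g by (rule g)
  interpret h: Vector_Spaces.linear witt_scale s h by (rule h)
  have "g (\<Sum>\<alpha>\<in>Poly_Mapping.keys x. witt_scale (Poly_Mapping.lookup x \<alpha>) (witt_basis \<alpha>)) =
      h (\<Sum>\<alpha>\<in>Poly_Mapping.keys x. witt_scale (Poly_Mapping.lookup x \<alpha>) (witt_basis \<alpha>))"
    by (simp add: g.sum h.sum g.scale h.scale eq)
  then show ?thesis
    by (simp only: witt_basis_expansion[symmetric])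
qed

lemma half_derivation_on_witt_basis:
  assumes lin: "Vector_Spaces.linear witt_scale witt_scale \<phi>"
    and basis: "\<And>\<alpha> \<beta>. \<phi> (witt_bracket f (witt_basis \<alpha>) (witt_basis \<beta>)) =
      witt_scale (1/2) (witt_bracket f (\<phi> (witt_basis \<alpha>)) (witt_basis \<beta>) +
        witt_bracket f (witt_basis \<alpha>) (\<phi> (witt_basis \<beta>)))"
  shows "half_derivation witt_scale (witt_bracket f) \<phi>"
proof -
  interpret V: vector_space "witt_scale :: complex \<Rightarrow> ('a \<Rightarrow>\<^sub>0 complex) \<Rightarrow> _"
    by (rule vector_space_witt_scale)
  have half_sum: "Vector_Spaces.linear witt_scale witt_scale (\<lambda>x. witt_scale (1/2) (g x + h x))"
    if "Vector_Spaces.linear witt_scale witt_scale g" "Vector_Spaces.linear witt_scale witt_scale h"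
    for g h :: "('a \<Rightarrow>\<^sub>0 complex) \<Rightarrow> ('a \<Rightarrow>\<^sub>0 complex)"
    using that unfolding Vector_Spaces.linear_iff
    by (auto simp: V.scale_right_distrib mult.commute)
  have comp: "Vector_Spaces.linear witt_scale witt_scale (\<lambda>x. g (h x))"
    if "Vector_Spaces.linear witt_scale witt_scale g" "Vector_Spaces.linear witt_scale witt_scale h"
    for g h :: "('a \<Rightarrow>\<^sub>0 complex) \<Rightarrow> ('a \<Rightarrow>\<^sub>0 complex)"
    using that unfolding Vector_Spaces.linear_iff by auto
  note bilin = bilinear_witt_bracket[of f]
  note linears = half_sum comp[OF lin] comp[OF bilin(1) lin] comp[OF bilin(2) lin] bilin
  have mixed: "\<phi> (witt_bracket f (witt_basis \<alpha>) y) =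
      witt_scale (1/2) (witt_bracket f (\<phi> (witt_basis \<alpha>)) y + witt_bracket f (witt_basis \<alpha>) (\<phi> y))"
    for \<alpha> y
    by (rule linear_eq_on_witt_basis[where s = witt_scale and x = y]) (rule linears basis)+
  have "\<phi> (witt_bracket f x y) =
      witt_scale (1/2) (witt_bracket f (\<phi> x) y + witt_bracket f x (\<phi> y))" for x y
    by (rule linear_eq_on_witt_basis[where s = witt_scale and x = x]) (rule linears mixed)+
  with lin show ?thesis
    by (auto simp: half_derivation_def)
qed

text \<open>
  The coefficients of \<open>\<phi> e\<^sub>\<alpha>\<close> are indexed by the shift \<open>\<delta>\<close> relative to \<open>\<alpha>\<close>, because comparing the
  coefficients at \<open>e\<^sub>\<alpha>\<^sub>+\<^sub>\<beta>\<^sub>+\<^sub>\<delta>\<close> then involves only coefficients with one and the same shift.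
\<close>

lemma half_derivation_iff_coefficients:
  fixes f :: "'g::ab_group_add \<Rightarrow> complex"
  assumes lin: "Vector_Spaces.linear witt_scale witt_scale \<phi>"
  defines "c \<equiv> \<lambda>\<alpha> \<delta>. Poly_Mapping.lookup (\<phi> (witt_basis \<alpha>)) (\<alpha> + \<delta>)"
  shows "half_derivation witt_scale (witt_bracket f) \<phi> \<longleftrightarrow>
    (\<forall>\<alpha> \<beta> \<delta>. 2 * (f \<beta> - f \<alpha>) * c (\<alpha> + \<beta>) \<delta> =
       (f \<beta> - f (\<alpha> + \<delta>)) * c \<alpha> \<delta> + (f (\<beta> + \<delta>) - f \<alpha>) * c \<beta> \<delta>)"
proof -
  interpret \<phi>: Vector_Spaces.linear witt_scale witt_scale \<phi> by (rule lin)
  let ?eq = "\<lambda>\<alpha> \<beta> \<delta>. 2 * (f \<beta> - f \<alpha>) * c (\<alpha> + \<beta>) \<delta> =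
       (f \<beta> - f (\<alpha> + \<delta>)) * c \<alpha> \<delta> + (f (\<beta> + \<delta>) - f \<alpha>) * c \<beta> \<delta>"
  have basis_iff: "\<phi> (witt_bracket f (witt_basis \<alpha>) (witt_basis \<beta>)) =
      witt_scale (1/2) (witt_bracket f (\<phi> (witt_basis \<alpha>)) (witt_basis \<beta>) +
        witt_bracket f (witt_basis \<alpha>) (\<phi> (witt_basis \<beta>))) \<longleftrightarrow> (\<forall>\<delta>. ?eq \<alpha> \<beta> \<delta>)"
    (is "?L = ?R \<longleftrightarrow> _") for \<alpha> \<beta>
  proof -
    have coeff: "Poly_Mapping.lookup ?L (\<alpha> + \<beta> + \<delta>) = Poly_Mapping.lookup ?R (\<alpha> + \<beta> + \<delta>)
        \<longleftrightarrow> ?eq \<alpha> \<beta> \<delta>" for \<delta>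
    proof -
      have "\<alpha> + \<beta> + \<delta> - \<beta> = \<alpha> + \<delta>" "\<alpha> + \<beta> + \<delta> - \<alpha> = \<beta> + \<delta>"
        by (simp_all add: algebra_simps)
      then have "Poly_Mapping.lookup ?R (\<alpha> + \<beta> + \<delta>) =
          1/2 * ((f \<beta> - f (\<alpha> + \<delta>)) * c \<alpha> \<delta> + (f (\<beta> + \<delta>) - f \<alpha>) * c \<beta> \<delta>)"
        by (simp only: lookup_witt_scale lookup_add c_def
            lookup_witt_bracket_basis_left lookup_witt_bracket_basis_right)
      moreover have "Poly_Mapping.lookup ?L (\<alpha> + \<beta> + \<delta>) = (f \<beta> - f \<alpha>) * c (\<alpha> + \<beta>) \<delta>"
        by (simp only: witt_bracket_basis \<phi>.scale lookup_witt_scale c_def)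
      ultimately show ?thesis
        by (simp only: mult.assoc) (simp add: eq_divide_eq mult.commute)
    qed
    then show ?thesis
      by (simp only: poly_mapping_eq_iff_shifted[of ?L ?R "\<alpha> + \<beta>"])
  qed
  show ?thesis
  proof
    assume "half_derivation witt_scale (witt_bracket f) \<phi>"
    then show "\<forall>\<alpha> \<beta> \<delta>. ?eq \<alpha> \<beta> \<delta>"
      unfolding half_derivation_def basis_iff[symmetric] by blast
  next
    assume "\<forall>\<alpha> \<beta> \<delta>. ?eq \<alpha> \<beta> \<delta>"
    then show "half_derivation witt_scale (witt_bracket f) \<phi>"
      by (intro half_derivation_on_witt_basis lin) (simp add: basis_iff)
  qed
qed

section \<open>Translations acting on the values of \<open>f\<close>\<close>

locale witt_function =
  fixes f :: "'g::ab_group_add \<Rightarrow> complex"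
  assumes f_zero [simp]: "f 0 = 0"
    and functional_equation: "(f (\<alpha> + \<beta>) - f \<alpha> - f \<beta>) * (f \<alpha> - f \<beta>) = 0"
begin

lemma add_if_values_differ: "f \<alpha> \<noteq> f \<beta> \<Longrightarrow> f (\<alpha> + \<beta>) = f \<alpha> + f \<beta>"
  using functional_equation[of \<alpha> \<beta>] by (simp add: diff_diff_eq)

lemma zero_uminus: "f \<gamma> = 0 \<Longrightarrow> f (- \<gamma>) = 0"
  using add_if_values_differ[of \<gamma> "- \<gamma>"] by fastforce

text \<open>
  The functional equation is silent about two elements of \<open>\<Gamma>\<^sub>0\<close>. If their sum had a nonzero value,
  subtracting one of them again would preserve that value, although the other one has value \<open>0\<close>.
\<close>

lemma zero_is_period:
  assumes "f \<gamma> = 0"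
  shows "f (\<alpha> + \<gamma>) = f \<alpha>"
proof (cases "f \<alpha> = 0")
  case True
  have "f (\<alpha> + \<gamma> + - \<gamma>) = f (\<alpha> + \<gamma>)" if "f (\<alpha> + \<gamma>) \<noteq> 0"
    using add_if_values_differ[of "\<alpha> + \<gamma>" "- \<gamma>"] that zero_uminus[OF assms] by simp
  with True show ?thesis by auto
next
  case False
  with add_if_values_differ[of \<alpha> \<gamma>] assms show ?thesis by simp
qed

end

locale three_valued_witt_function = witt_function +
  assumes card_range: "card (range f) = 3"
begin

lemma ex_value_nonzero: "\<exists>\<alpha>. f \<alpha> \<noteq> 0"
proof (rule ccontr)
  assume "\<not> ?thesis"
  then have "range f = {0}" by auto
  with card_range show False by simp
qed

text \<open>The sum of the two nonzero values is a value different from both of them, hence zero.\<close>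

lemma range_eq:
  assumes "f \<delta> \<noteq> 0"
  shows "range f = {0, f \<delta>, - f \<delta>}"
proof -
  have fin: "finite (range f)"
    using card_range by (intro card_ge_0_finite) simp
  have sub: "{0, f \<delta>} \<subseteq> range f"
    using f_zero by (metis empty_subsetI insert_subset rangeI)
  have "card (range f - {0, f \<delta>}) = 1"
    using assms card_range by (subst card_Diff_subset[OF _ sub]) auto
  then obtain e where e: "range f - {0, f \<delta>} = {e}"
    by (auto simp: card_1_singleton_iff)
  with sub have range: "range f = {0, f \<delta>, e}" by blast
  from e have e_new: "e \<noteq> 0" "e \<noteq> f \<delta>" by blast+
  from range obtain \<epsilon> where \<epsilon>: "f \<epsilon> = e" by (metis insertCI imageE)
  have "f \<delta> + e \<in> {0, f \<delta>, e}"
    using add_if_values_differ[of \<delta> \<epsilon>] \<epsilon> e_new range by (metis rangeI)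
  with assms e_new have "e = - f \<delta>"
    by (auto simp: add_eq_0_iff)
  with range show ?thesis by simp
qed

lemma value_cases:
  assumes "f \<delta> \<noteq> 0"
  obtains "f \<alpha> = 0" | "f \<alpha> = f \<delta>" | "f \<alpha> = - f \<delta>"
  using range_eq[OF assms] by blast

lemma ex_opposite_value: "f \<delta> \<noteq> 0 \<Longrightarrow> \<exists>\<epsilon>. f \<epsilon> = - f \<delta>"
  using range_eq[of \<delta>] by (auto simp: set_eq_iff image_iff) metis

lemma add_opposite_value: "f \<alpha> = - f \<beta> \<Longrightarrow> f \<beta> \<noteq> 0 \<Longrightarrow> f (\<alpha> + \<beta>) = 0"
  using add_if_values_differ[of \<alpha> \<beta>] by auto

text \<open>
  The functional equation does not determine this value directly. Take \<open>\<epsilon>\<close> of value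
  \<open>- f \<delta>\<close>: then \<open>\<delta> + \<epsilon>\<close> is a period, so translating \<open>\<alpha> + \<delta>\<close> by \<open>\<epsilon>\<close> gives the value \<open>f \<delta>\<close>,
  which is impossible if \<open>\<alpha> + \<delta>\<close> has value \<open>0\<close> or \<open>f \<delta>\<close>.
\<close>

lemma add_same_value:
  assumes "f \<delta> \<noteq> 0" "f \<alpha> = f \<delta>"
  shows "f (\<alpha> + \<delta>) = - f \<delta>"
proof -
  obtain \<epsilon> where \<epsilon>: "f \<epsilon> = - f \<delta>" using ex_opposite_value assms(1) by blast
  have "f (\<delta> + \<epsilon>) = 0"
    using add_opposite_value[OF \<epsilon> assms(1)] by (simp add: add.commute)
  then have returned: "f (\<alpha> + \<delta> + \<epsilon>) = f \<delta>"
    using zero_is_period[of "\<delta> + \<epsilon>" \<alpha>] assms(2) by (simp add: add.assoc)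
  show ?thesis
  proof (rule value_cases[OF assms(1), of "\<alpha> + \<delta>"])
    assume "f (\<alpha> + \<delta>) = 0"
    with add_if_values_differ[of "\<alpha> + \<delta>" \<epsilon>] \<epsilon> returned assms(1) show ?thesis by simp
  next
    assume "f (\<alpha> + \<delta>) = f \<delta>"
    with add_if_values_differ[of "\<alpha> + \<delta>" \<epsilon>] \<epsilon> returned assms(1) show ?thesis by simp
  qed
qed

section \<open>Solving the coefficient equation\<close>

lemma shift_in_zero_set_coefficients_constant:
  fixes c :: "'a \<Rightarrow> complex"
  assumes \<delta>: "f \<delta> = 0"
    and eq: "\<And>\<alpha> \<beta>. 2 * (f \<beta> - f \<alpha>) * c (\<alpha> + \<beta>) =
      (f \<beta> - f (\<alpha> + \<delta>)) * c \<alpha> + (f (\<beta> + \<delta>) - f \<alpha>) * c \<beta>"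
  shows "c \<alpha> = c 0"
proof -
  have mean: "2 * c (\<alpha> + \<beta>) = c \<alpha> + c \<beta>" if "f \<alpha> \<noteq> f \<beta>" for \<alpha> \<beta>
  proof -
    have "(f \<beta> - f \<alpha>) * (2 * c (\<alpha> + \<beta>)) = (f \<beta> - f \<alpha>) * (c \<alpha> + c \<beta>)"
      using eq[of \<beta> \<alpha>] by (simp add: zero_is_period[OF \<delta>] algebra_simps)
    with that show ?thesis by simp
  qed
  have nonzero: "c \<alpha> = c 0" if "f \<alpha> \<noteq> 0" for \<alpha>
    using mean[of \<alpha> 0] that by simp
  show ?thesis
  proof (cases "f \<alpha> = 0")
    case True
    \<comment> \<open>An element of \<open>\<Gamma>\<^sub>0\<close> is a sum of two elements with opposite nonzero values.\<close>
    obtain \<beta> where \<beta>: "f \<beta> \<noteq> 0" using ex_value_nonzero by blast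
    obtain \<epsilon> where \<epsilon>: "f \<epsilon> = - f \<beta>" using ex_opposite_value \<beta> by blast
    have "f (- (\<epsilon> + \<beta>)) = 0"
      using add_opposite_value[OF \<epsilon> \<beta>] zero_uminus by blast
    then have "f (\<epsilon> + (\<alpha> + - (\<epsilon> + \<beta>))) = f \<epsilon>"
      using zero_is_period True by metis
    moreover have "\<epsilon> + (\<alpha> + - (\<epsilon> + \<beta>)) = \<alpha> - \<beta>" by (simp add: algebra_simps)
    ultimately have opp: "f (\<alpha> - \<beta>) = - f \<beta>" using \<epsilon> by simp
    have "c (\<alpha> - \<beta>) = c 0" "c \<beta> = c 0"
      using nonzero \<beta> opp by simp_all
    moreover have "2 * c (\<alpha> - \<beta> + \<beta>) = c (\<alpha> - \<beta>) + c \<beta>"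
      using \<beta> opp by (intro mean) simp
    ultimately show ?thesis by simp
  qed (rule nonzero)
qed

text \<open>
  With \<open>d = f \<delta>\<close>, the case \<open>\<beta> = 0\<close> gives \<open>c = 0\<close> on elements of value \<open>d\<close> and \<open>c = c 0\<close> on the
  others. A pair of values \<open>d, -d\<close> then yields \<open>- 4 d c 0 = - d c 0\<close>.
\<close>

lemma shift_outside_zero_set_coefficients_vanish:
  fixes c :: "'a \<Rightarrow> complex"
  assumes \<delta>: "f \<delta> \<noteq> 0"
    and eq: "\<And>\<alpha> \<beta>. 2 * (f \<beta> - f \<alpha>) * c (\<alpha> + \<beta>) =
      (f \<beta> - f (\<alpha> + \<delta>)) * c \<alpha> + (f (\<beta> + \<delta>) - f \<alpha>) * c \<beta>"
  shows "c \<alpha> = 0"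
proof -
  have on_zero: "c \<alpha> = c 0" if "f \<alpha> = 0" for \<alpha>
  proof -
    have "f (\<alpha> + \<delta>) = f \<delta>"
      using zero_is_period[OF that, of \<delta>] by (simp add: add.commute)
    with eq[of 0 \<alpha>] that \<delta> show ?thesis by simp
  qed
  have on_same: "c \<alpha> = 0" if "f \<alpha> = f \<delta>" for \<alpha>
    using eq[of 0 \<alpha>] add_same_value[OF \<delta> that] that \<delta> by simp
  have on_opposite: "c \<alpha> = c 0" if "f \<alpha> = - f \<delta>" for \<alpha>
    using eq[of 0 \<alpha>] add_opposite_value[OF that \<delta>] that \<delta> by simp
  obtain \<epsilon> where \<epsilon>: "f \<epsilon> = - f \<delta>" using ex_opposite_value \<delta> by blast
  have sum: "f (\<epsilon> + \<delta>) = 0" by (rule add_opposite_value[OF \<epsilon> \<delta>])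
  have "c (\<delta> + \<epsilon>) = c 0"
    using on_zero[OF sum] by (simp add: add.commute)
  then have "- 4 * f \<delta> * c 0 = - f \<delta> * c 0"
    using eq[of \<epsilon> \<delta>] on_same[of \<delta>] on_opposite[OF \<epsilon>] sum \<epsilon> by simp
  with \<delta> have "c 0 = 0" by simp
  then show ?thesis
    using on_zero[of \<alpha>] on_same[of \<alpha>] on_opposite[of \<alpha>] value_cases[OF \<delta>, of \<alpha>] by metis
qed

end

lemma lookup_sum_shifted_basis:
  fixes a :: "'g::ab_group_add \<Rightarrow> complex"
  assumes "finite A"
  shows "Poly_Mapping.lookup (\<Sum>\<gamma>\<in>A. witt_scale (a \<gamma>) (witt_basis (\<alpha> + \<gamma>))) (\<alpha> + \<delta>) =
    (if \<delta> \<in> A then a \<delta> else 0)"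
proof -
  have "Poly_Mapping.lookup (\<Sum>\<gamma>\<in>A. witt_scale (a \<gamma>) (witt_basis (\<alpha> + \<gamma>))) (\<alpha> + \<delta>) =
      (\<Sum>\<gamma>\<in>A. if \<gamma> = \<delta> then a \<gamma> else 0)"
    by (auto simp: lookup_sum witt_basis_def lookup_single when_def intro!: sum.cong)
  with assms show ?thesis by simp
qed

theorem proposition18:
  fixes f :: "'g::ab_group_add \<Rightarrow> complex"
    and \<phi> :: "('g \<Rightarrow>\<^sub>0 complex) \<Rightarrow> ('g \<Rightarrow>\<^sub>0 complex)"
  assumes "f 0 = 0"
    and "\<And>\<alpha> \<beta>. (f (\<alpha> + \<beta>) - f \<alpha> - f \<beta>) * (f \<alpha> - f \<beta>) = 0"
    and "card (range f) = 3"
  defines "\<Gamma>\<^sub>0 \<equiv> f -` {0}"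
  shows "half_derivation witt_scale (witt_bracket f) \<phi> \<longleftrightarrow>
    Vector_Spaces.linear witt_scale witt_scale \<phi> \<and>
    (\<exists>a :: 'g \<Rightarrow> complex. finite {\<gamma> \<in> \<Gamma>\<^sub>0. a \<gamma> \<noteq> 0} \<and>
       (\<forall>\<alpha>. \<phi> (witt_basis \<alpha>) =
          (\<Sum>\<gamma> \<in> {\<gamma> \<in> \<Gamma>\<^sub>0. a \<gamma> \<noteq> 0}. witt_scale (a \<gamma>) (witt_basis (\<alpha> + \<gamma>)))))"
proof -
  interpret three_valued_witt_function f
    by unfold_locales (fact assms)+
  define c where "c = (\<lambda>\<alpha> \<delta>. Poly_Mapping.lookup (\<phi> (witt_basis \<alpha>)) (\<alpha> + \<delta>))"
  let ?shifts = "\<lambda>a. {\<gamma> \<in> \<Gamma>\<^sub>0. a \<gamma> \<noteq> 0}"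
  let ?lin = "Vector_Spaces.linear witt_scale witt_scale \<phi>"
  let ?eq = "\<lambda>\<alpha> \<beta> \<delta>. 2 * (f \<beta> - f \<alpha>) * c (\<alpha> + \<beta>) \<delta> =
       (f \<beta> - f (\<alpha> + \<delta>)) * c \<alpha> \<delta> + (f (\<beta> + \<delta>) - f \<alpha>) * c \<beta> \<delta>"
  have form_iff: "\<phi> (witt_basis \<alpha>) = (\<Sum>\<gamma>\<in>?shifts a. witt_scale (a \<gamma>) (witt_basis (\<alpha> + \<gamma>)))
      \<longleftrightarrow> (\<forall>\<delta>. c \<alpha> \<delta> = (if \<delta> \<in> \<Gamma>\<^sub>0 then a \<delta> else 0))" (is "_ = ?S \<longleftrightarrow> _")
    if "finite (?shifts a)" for a :: "'g \<Rightarrow> complex" and \<alpha>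
  proof -
    have "\<phi> (witt_basis \<alpha>) = ?S \<longleftrightarrow> (\<forall>\<delta>. c \<alpha> \<delta> = Poly_Mapping.lookup ?S (\<alpha> + \<delta>))"
      unfolding c_def by (rule poly_mapping_eq_iff_shifted)
    moreover have "Poly_Mapping.lookup ?S (\<alpha> + \<delta>) = (if \<delta> \<in> \<Gamma>\<^sub>0 then a \<delta> else 0)" for \<delta>
      by (simp add: lookup_sum_shifted_basis[OF that])
    ultimately show ?thesis
      by (simp only:)
  qed
  have solutions: "(\<forall>\<alpha> \<beta> \<delta>. ?eq \<alpha> \<beta> \<delta>) \<longleftrightarrow>
      (\<forall>\<alpha> \<delta>. c \<alpha> \<delta> = (if \<delta> \<in> \<Gamma>\<^sub>0 then c 0 \<delta> else 0))"
  proof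
    assume eq: "\<forall>\<alpha> \<beta> \<delta>. ?eq \<alpha> \<beta> \<delta>"
    show "\<forall>\<alpha> \<delta>. c \<alpha> \<delta> = (if \<delta> \<in> \<Gamma>\<^sub>0 then c 0 \<delta> else 0)"
    proof (intro allI)
      fix \<alpha> \<delta>
      have "c \<alpha> \<delta> = c 0 \<delta>" if "f \<delta> = 0"
        by (rule shift_in_zero_set_coefficients_constant[OF that]) (rule eq[rule_format])
      moreover have "c \<alpha> \<delta> = 0" if "f \<delta> \<noteq> 0"
        by (rule shift_outside_zero_set_coefficients_vanish[OF that]) (rule eq[rule_format])
      ultimately show "c \<alpha> \<delta> = (if \<delta> \<in> \<Gamma>\<^sub>0 then c 0 \<delta> else 0)"
        by (simp add: \<Gamma>\<^sub>0_def)
    qed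
  next
    assume const: "\<forall>\<alpha> \<delta>. c \<alpha> \<delta> = (if \<delta> \<in> \<Gamma>\<^sub>0 then c 0 \<delta> else 0)"
    show "\<forall>\<alpha> \<beta> \<delta>. ?eq \<alpha> \<beta> \<delta>"
    proof (intro allI)
      fix \<alpha> \<beta> \<delta>
      show "?eq \<alpha> \<beta> \<delta>"
      proof (cases "f \<delta> = 0")
        case True
        then have "c \<alpha> \<delta> = c 0 \<delta>" "c \<beta> \<delta> = c 0 \<delta>" "c (\<alpha> + \<beta>) \<delta> = c 0 \<delta>"
          using const by (metis \<Gamma>\<^sub>0_def vimage_singleton_eq)+
        then show ?thesis by (simp only: zero_is_period[OF True]) (simp add: algebra_simps)
      next
        case False
        then have "c \<alpha> \<delta> = 0" "c \<beta> \<delta> = 0" "c (\<alpha> + \<beta>) \<delta> = 0"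
          using const by (metis \<Gamma>\<^sub>0_def vimage_singleton_eq)+
        then show ?thesis by simp
      qed
    qed
  qed
  \<comment> \<open>A family \<open>a\<close> as required must agree on \<open>\<Gamma>\<^sub>0\<close> with the coefficients of \<open>\<phi> e\<^sub>0\<close>.\<close>
  have "(\<exists>a. finite (?shifts a) \<and> (\<forall>\<alpha>. \<phi> (witt_basis \<alpha>) =
        (\<Sum>\<gamma>\<in>?shifts a. witt_scale (a \<gamma>) (witt_basis (\<alpha> + \<gamma>))))) \<longleftrightarrow>
      (\<forall>\<alpha> \<delta>. c \<alpha> \<delta> = (if \<delta> \<in> \<Gamma>\<^sub>0 then c 0 \<delta> else 0))" (is "?form \<longleftrightarrow> ?const")
  proof
    assume ?form
    then obtain a :: "'g \<Rightarrow> complex" where "\<forall>\<alpha> \<delta>. c \<alpha> \<delta> = (if \<delta> \<in> \<Gamma>\<^sub>0 then a \<delta> else 0)"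
      using form_iff by blast
    then show ?const by simp
  next
    assume ?const
    have "finite (?shifts (c 0))"
      by (rule finite_subset[OF _ finite_keys[of "\<phi> (witt_basis 0)"]])
        (auto simp: c_def in_keys_iff)
    with form_iff[OF this] \<open>?const\<close> show ?form by blast
  qed
  moreover have "half_derivation witt_scale (witt_bracket f) \<phi> \<longleftrightarrow> ?lin \<and> (\<forall>\<alpha> \<beta> \<delta>. ?eq \<alpha> \<beta> \<delta>)"
  proof (cases ?lin)
    case True
    then show ?thesis
      unfolding c_def by (simp only: half_derivation_iff_coefficients[OF True] simp_thms)
  next
    case False
    then show ?thesis
      by (simp only: half_derivation_def simp_thms)
  qed
  ultimately show ?thesis
    using solutions by blast
qed

end
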